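(* Let $\mathcal{P}\subseteq\mathbb{R}^n$ be a polytope and fix any $x\in\mathcal{P}$. Let $h:\mathcal{P}\to\mathbb{R}$ be a differentiable convex function and let $x^*\in\arg\min_{z\in\mathcal{P}}h(z)$. Then $\|d_x^\Pi\|=0$ if and only if $x\in\arg\min_{z\in\mathcal{P}}h(z)$. Moreover, if $h$ is $\mu$-strongly convex over $\mathcal{P}$, then $$\|d_x^\Pi\|^2\ge2\mu\,(h(x)-h(x^* )).$$
   Context: $\Pi_{\mathcal{P}}$ is Euclidean projection onto $\mathcal{P}$, and $d_x^\Pi=\lim_{\epsilon\downarrow0}\frac{\Pi_{\mathcal{P}}(x-\epsilon\nabla h(x))-x}{\epsilon}$ is the shadow of the negative gradient at $x$; equivalently, it is the Euclidean projection of $-\nabla h(x)$ onto the tangent cone $\mathrm{cone}(\mathcal{P}-x)$. $h$ is $\mu$-strongly convex if $h(y)\ge h(x)+\langle\nabla h(x),y-x\rangle+\frac\mu2\|y-x\|^2$ for all $x,y\in\mathcal{P}$. *)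

theory Defs
  imports "HOL-Analysis.Analysis"
begin

text \<open>
  \<open>g\<close> is a gradient field of \<open>h\<close> on \<open>P\<close>. The derivative is taken within \<open>P\<close>, since \<open>h\<close> only has
  to be defined there. If \<open>P\<close> is not full-dimensional, \<open>g\<close> is not unique, but its component
  orthogonal to the affine hull of \<open>P\<close> affects neither \<open>shadow\<close> nor \<open>strongly_convex_on\<close>.
\<close>
definition has_gradient_on ::
    "(real^'n \<Rightarrow> real) \<Rightarrow> (real^'n \<Rightarrow> real^'n) \<Rightarrow> (real^'n) set \<Rightarrow> bool" where
  "has_gradient_on h g P \<longleftrightarrow>
     (\<forall>z\<in>P. (h has_derivative (\<lambda>v. g z \<bullet> v)) (at z within P))"

text \<open>
  The shadow at \<open>x\<close> of the negative of the gradient field \<open>g\<close>. As \<open>Lim\<close> is a definite description,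
  it carries no information unless the limit exists.
\<close>
definition shadow :: "(real^'n) set \<Rightarrow> (real^'n \<Rightarrow> real^'n) \<Rightarrow> real^'n \<Rightarrow> real^'n" where
  "shadow P g x =
     Lim (at_right 0) (\<lambda>\<epsilon>::real. (closest_point P (x - \<epsilon> *\<^sub>R g x) - x) /\<^sub>R \<epsilon>)"

definition strongly_convex_on ::
    "real \<Rightarrow> (real^'n) set \<Rightarrow> (real^'n \<Rightarrow> real) \<Rightarrow> (real^'n \<Rightarrow> real^'n) \<Rightarrow> bool" where
  "strongly_convex_on \<mu> P h g \<longleftrightarrow>
     (\<forall>x\<in>P. \<forall>y\<in>P. h y \<ge> h x + g x \<bullet> (y - x) + \<mu> / 2 * (norm (y - x))\<^sup>2)"

end

theory Submission
  imports Defs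
begin

text \<open>
  Near \<open>x\<close> a polyhedron coincides with the translate by \<open>x\<close> of its cone of feasible directions, and
  this cone is closed. For small steps, projecting \<open>x - \<epsilon> *\<^sub>R g x\<close> onto \<open>P\<close> is therefore the same
  as projecting \<open>- g x\<close> onto the cone and scaling the result by \<open>\<epsilon>\<close>: the difference quotient that
  defines the shadow is eventually constant, and the shadow \<open>d\<close> is the projection of \<open>- g x\<close> onto the
  cone (\<open>shadow_eq_closest_point_feasible_directions\<close>).

  Projection onto a convex cone is characterised by Moreau's conditions: \<open>- g x \<bullet> d = d \<bullet> d\<close>, and
  \<open>- g x \<bullet> w \<le> d \<bullet> w\<close> for every feasible direction \<open>w\<close>. If \<open>d = 0\<close>, the second condition says that no
  feasible direction is one of descent to first order, which for a convex function is optimality.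
  If \<open>x\<close> is optimal, the feasible direction \<open>d\<close> is not one of descent, and the first condition gives
  \<open>d \<bullet> d \<le> 0\<close>. For the quantitative bound put \<open>w = xstar - x\<close>. Strong convexity and the second
  condition give \<open>h x - h xstar \<le> d \<bullet> w - \<mu> / 2 * (w \<bullet> w)\<close>; after multiplication by
  \<open>2 * \<mu>\<close> the right-hand side is \<open>d \<bullet> d\<close> minus the square of the norm of \<open>d - \<mu> *\<^sub>R w\<close>. This uses
  \<open>\<mu> > 0\<close>; otherwise the bound is at most \<open>0\<close>.
\<close>

definition feasible_directions :: "'a::real_vector set \<Rightarrow> 'a \<Rightarrow> 'a set" where
  "feasible_directions S x = {d. \<exists>\<delta>>0. x + \<delta> *\<^sub>R d \<in> S}"

lemma zero_feasible_direction: "x \<in> S \<Longrightarrow> 0 \<in> feasible_directions S x"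
  by (auto simp: feasible_directions_def intro: exI[of _ 1])

lemma diff_feasible_direction:
  assumes "y \<in> S"
  shows "y - x \<in> feasible_directions S x"
  using assms by (auto simp: feasible_directions_def intro: exI[of _ 1])

lemma scaleR_feasible_direction:
  assumes "d \<in> feasible_directions S x" "c > 0"
  shows "c *\<^sub>R d \<in> feasible_directions S x"
proof -
  obtain \<delta> where "\<delta> > 0" "x + \<delta> *\<^sub>R d \<in> S"
    using assms(1) by (auto simp: feasible_directions_def)
  then have "\<delta> / c > 0 \<and> x + (\<delta> / c) *\<^sub>R (c *\<^sub>R d) \<in> S"
    using assms(2) by simp
  then show ?thesis
    unfolding feasible_directions_def by blast
qed

lemma convex_segment_to_step:
  fixes S :: "'a::real_vector set"
  assumes "convex S" "x \<in> S" "x + \<delta> *\<^sub>R d \<in> S" "0 \<le> t" "t \<le> \<delta>"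
  shows "x + t *\<^sub>R d \<in> S"
proof (cases "\<delta> = 0")
  case False
  then have "\<delta> > 0"
    using assms(4,5) by simp
  have "x + (t / \<delta>) *\<^sub>R (x + \<delta> *\<^sub>R d - x) \<in> S"
    using convexD_alt[OF assms(1-3), of "t / \<delta>"] assms(4,5) \<open>\<delta> > 0\<close>
    by (simp add: algebra_simps)
  then show ?thesis
    using \<open>\<delta> > 0\<close> by simp
qed (use assms in simp)

lemma eventually_feasible_step:
  fixes S :: "'a::real_vector set"
  assumes "convex S" "x \<in> S" "d \<in> feasible_directions S x"
  shows "eventually (\<lambda>t. x + t *\<^sub>R d \<in> S) (at_right (0::real))"
proof -
  obtain \<delta> where "\<delta> > 0" "x + \<delta> *\<^sub>R d \<in> S"
    using assms(3) by (auto simp: feasible_directions_def)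
  then show ?thesis
    unfolding eventually_at_right_field
    using convex_segment_to_step[OF assms(1,2)] by (intro exI[of _ \<delta>]) force
qed

text \<open>
  Only the defining inequalities that are tight at \<open>x\<close> restrict the feasible directions, since a small
  step cannot exhaust the slack of the finitely many others. So the feasible directions are cut out
  by homogeneous linear inequalities.
\<close>
lemma polyhedron_feasible_directions:
  fixes S :: "'a::euclidean_space set"
  assumes "polyhedron S" "x \<in> S"
  shows "closed (feasible_directions S x) \<and> convex (feasible_directions S x)"
proof -
  obtain F where F: "finite F" "S = \<Inter>F"
    and "\<forall>H\<in>F. \<exists>a b. a \<noteq> 0 \<and> H = {y. a \<bullet> y \<le> b}"
    using assms(1) unfolding polyhedron_def by blast
  then obtain a b where H: "\<And>H. H \<in> F \<Longrightarrow> H = {y. a H \<bullet> y \<le> b H}"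
    by metis
  define A where "A = {H\<in>F. a H \<bullet> x = b H}"
  have slack: "a H \<bullet> x \<le> b H" if "H \<in> F" for H
    using assms(2) F(2) H[OF that] that by blast
  have "feasible_directions S x = (\<Inter>H\<in>A. {d. a H \<bullet> d \<le> 0})"
  proof (intro equalityI subsetI INT_I CollectI)
    fix d H assume "d \<in> feasible_directions S x" "H \<in> A"
    then obtain \<delta> where "\<delta> > 0" "x + \<delta> *\<^sub>R d \<in> H"
      using F(2) by (auto simp: feasible_directions_def A_def)
    then have "a H \<bullet> (x + \<delta> *\<^sub>R d) \<le> b H"
      using H \<open>H \<in> A\<close> unfolding A_def by blast
    then have "\<delta> * (a H \<bullet> d) \<le> 0"
      using \<open>H \<in> A\<close> by (simp add: A_def inner_add_right)
    then show "a H \<bullet> d \<le> 0"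
      using \<open>\<delta> > 0\<close> by (simp add: mult_le_0_iff)
  next
    fix d assume d: "d \<in> (\<Inter>H\<in>A. {d. a H \<bullet> d \<le> 0})"
    have "eventually (\<lambda>t. a H \<bullet> (x + t *\<^sub>R d) \<le> b H) (at_right (0::real))" if "H \<in> F" for H
    proof (cases "a H \<bullet> x = b H")
      case True
      then have "a H \<bullet> d \<le> 0"
        using d that by (auto simp: A_def)
      then have "a H \<bullet> (x + t *\<^sub>R d) \<le> b H" if "t > 0" for t
        using True that by (simp add: inner_add_right mult_le_0_iff)
      then show ?thesis
        by (auto simp: eventually_at_right_field intro: exI[of _ 1])
    next
      case False
      have "((\<lambda>t. a H \<bullet> (x + t *\<^sub>R d)) \<longlongrightarrow> a H \<bullet> (x + 0 *\<^sub>R d)) (at_right (0::real))"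
        by (intro tendsto_intros)
      then have "eventually (\<lambda>t. a H \<bullet> (x + t *\<^sub>R d) < b H) (at_right (0::real))"
        using slack[OF that] False by (intro order_tendstoD) auto
      then show ?thesis
        by (rule eventually_mono) simp
    qed
    then have "eventually (\<lambda>t. \<forall>H\<in>F. a H \<bullet> (x + t *\<^sub>R d) \<le> b H) (at_right (0::real))"
      using F(1) by (intro eventually_ball_finite) auto
    then have "eventually (\<lambda>t. t > 0 \<and> (\<forall>H\<in>F. a H \<bullet> (x + t *\<^sub>R d) \<le> b H)) (at_right (0::real))"
      by (intro eventually_conj eventually_at_right_less)
    then obtain t :: real where "t > 0" and t: "\<forall>H\<in>F. a H \<bullet> (x + t *\<^sub>R d) \<le> b H"
      by (blast dest: eventually_happens'[OF trivial_limit_at_right_real])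
    have "x + t *\<^sub>R d \<in> S"
      using F(2) H t by blast
    with \<open>t > 0\<close> show "d \<in> feasible_directions S x"
      by (auto simp: feasible_directions_def)
  qed
  moreover have "closed (\<Inter>H\<in>A. {d. a H \<bullet> d \<le> 0})"
    by (intro closed_INT ballI closed_halfspace_le)
  moreover have "convex (\<Inter>H\<in>A. {d. a H \<bullet> d \<le> 0})"
    by (intro convex_INT convex_halfspace_le)
  ultimately show ?thesis
    by simp
qed

text \<open>
  Every point of \<open>S\<close> is \<open>x + t *\<^sub>R w\<close> for some feasible direction \<open>w\<close>, so by scaling the projection of
  \<open>v\<close> onto the cone competes successfully with all of \<open>S\<close>; for small \<open>t\<close> it moreover leads to a point
  of \<open>S\<close>.
\<close>
lemma eventually_closest_point_polyhedron:
  fixes S :: "'a::euclidean_space set" and v :: 'a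
  assumes "polyhedron S" "x \<in> S"
  defines "d \<equiv> closest_point (feasible_directions S x) v"
  shows "eventually (\<lambda>t. closest_point S (x + t *\<^sub>R v) = x + t *\<^sub>R d) (at_right (0::real))"
proof -
  let ?T = "feasible_directions S x"
  have T: "closed ?T" "?T \<noteq> {}"
    using polyhedron_feasible_directions[OF assms(1,2)] zero_feasible_direction[OF assms(2)]
    by auto
  have S: "convex S" "closed S"
    using assms(1) by (auto intro: polyhedron_imp_convex polyhedron_imp_closed)
  have "d \<in> ?T"
    unfolding d_def by (rule closest_point_in_set[OF T])
  with S(1) assms(2) have "eventually (\<lambda>t. x + t *\<^sub>R d \<in> S) (at_right (0::real))"
    by (rule eventually_feasible_step)
  then show ?thesis
    using eventually_at_right_less
  proof eventually_elim
    case (elim t)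
    have "dist (x + t *\<^sub>R v) (x + t *\<^sub>R d) \<le> dist (x + t *\<^sub>R v) y" if "y \<in> S" for y
    proof -
      define w where "w = (1 / t) *\<^sub>R (y - x)"
      have "w \<in> ?T"
        unfolding w_def
        using elim(2) by (intro scaleR_feasible_direction diff_feasible_direction that) simp
      then have "dist v d \<le> dist v w"
        unfolding d_def by (rule closest_point_le[OF T(1)])
      moreover have "y = x + t *\<^sub>R w"
        using elim(2) by (simp add: w_def)
      ultimately show ?thesis
        using elim(2) by (simp add: dist_norm flip: scaleR_diff_right)
    qed
    then show ?case
      using closest_point_unique[OF S elim(1)] by metis
  qed
qed

lemma shadow_eq_closest_point_feasible_directions:
  assumes "polyhedron P" "x \<in> P"
  shows "shadow P g x = closest_point (feasible_directions P x) (- g x)" (is "_ = ?d")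
proof -
  have "eventually (\<lambda>\<epsilon>. ?d = (closest_point P (x - \<epsilon> *\<^sub>R g x) - x) /\<^sub>R \<epsilon>) (at_right (0::real))"
    using eventually_closest_point_polyhedron[OF assms, of "- g x"] eventually_at_right_less
    by eventually_elim simp
  then have "((\<lambda>\<epsilon>::real. (closest_point P (x - \<epsilon> *\<^sub>R g x) - x) /\<^sub>R \<epsilon>) \<longlongrightarrow> ?d) (at_right 0)"
    by (rule Lim_transform_eventually[OF tendsto_const])
  then show ?thesis
    unfolding shadow_def by (intro tendsto_Lim trivial_limit_at_right_real)
qed

text \<open>
  Moreau's characterisation of the projection onto a convex cone. Both parts come from the obtuse angle
  criterion, applied to the competitors \<open>0\<close> and \<open>2 *\<^sub>R d\<close> on the ray through \<open>d\<close>, and to \<open>w\<close> itself.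
\<close>
lemma closest_point_convex_cone:
  fixes T :: "'a::euclidean_space set" and v :: 'a
  assumes "closed T" "convex T" "0 \<in> T"
    and cone: "\<And>c w. c > 0 \<Longrightarrow> w \<in> T \<Longrightarrow> c *\<^sub>R w \<in> T"
  defines "d \<equiv> closest_point T v"
  shows "v \<bullet> d = d \<bullet> d" and "\<And>w. w \<in> T \<Longrightarrow> v \<bullet> w \<le> d \<bullet> w"
proof -
  have "d \<in> T"
    unfolding d_def using assms(1,3) by (intro closest_point_in_set) auto
  have obtuse: "(v - d) \<bullet> (w - d) \<le> 0" if "w \<in> T" for w
    unfolding d_def by (rule closest_point_dot[OF assms(2,1) that])
  show eq: "v \<bullet> d = d \<bullet> d"
    using obtuse[OF assms(3)] obtuse[OF cone[of 2, OF _ \<open>d \<in> T\<close>]]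
    by (simp add: algebra_simps)
  show "v \<bullet> w \<le> d \<bullet> w" if "w \<in> T" for w
    using obtuse[OF that] eq by (simp add: algebra_simps)
qed

text \<open>
  The derivative within \<open>P\<close> says nothing about approach from outside \<open>P\<close>; restricted to a segment
  that stays in \<open>P\<close> it becomes an ordinary one-sided derivative in one variable.
\<close>
lemma gradient_directional_limit:
  assumes "has_gradient_on h g P" "convex P" "x \<in> P" "d \<in> feasible_directions P x"
  shows "((\<lambda>t. (h (x + t *\<^sub>R d) - h x) / t) \<longlongrightarrow> g x \<bullet> d) (at_right (0::real))"
proof -
  obtain \<delta> where \<delta>: "\<delta> > 0" "x + \<delta> *\<^sub>R d \<in> P"
    using assms(4) by (auto simp: feasible_directions_def)
  let ?p = "\<lambda>t::real. x + t *\<^sub>R d"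
  have "?p ` {0..\<delta>} \<subseteq> P"
    using convex_segment_to_step[OF assms(2,3) \<delta>(2)] by auto
  moreover have "(h has_derivative (\<lambda>v. g x \<bullet> v)) (at (?p 0) within P)"
    using assms(1,3) by (simp add: has_gradient_on_def)
  ultimately have "(h has_derivative (\<lambda>v. g x \<bullet> v)) (at (?p 0) within ?p ` {0..\<delta>})"
    by (blast intro: has_derivative_subset)
  moreover have "(?p has_derivative (\<lambda>t. t *\<^sub>R d)) (at 0 within {0..\<delta>})"
    by (auto intro!: derivative_eq_intros)
  ultimately have "(h \<circ> ?p has_derivative (\<lambda>v. g x \<bullet> v) \<circ> (\<lambda>t. t *\<^sub>R d)) (at 0 within {0..\<delta>})"
    by (intro diff_chain_within)
  then have "((\<lambda>t. h (?p t)) has_field_derivative g x \<bullet> d) (at 0 within {0..\<delta>})"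
    by (simp add: has_field_derivative_def o_def mult_commute_abs)
  then show ?thesis
    using \<delta>(1) by (simp add: has_field_derivative_iff at_within_Icc_at_right)
qed

lemma convex_on_gradient_inequality:
  assumes "has_gradient_on h g P" "convex_on P h" "x \<in> P" "y \<in> P"
  shows "h x + g x \<bullet> (y - x) \<le> h y"
proof -
  have "(h (x + t *\<^sub>R (y - x)) - h x) / t \<le> h y - h x" if "t > 0" "t < 1" for t
  proof -
    have "h ((1 - t) *\<^sub>R x + t *\<^sub>R y) \<le> (1 - t) * h x + t * h y"
      using that assms(2-4) by (intro convex_onD) auto
    then show ?thesis
      using that by (simp add: field_simps scaleR_diff_left scaleR_diff_right)
  qed
  then have "eventually (\<lambda>t. (h (x + t *\<^sub>R (y - x)) - h x) / t \<le> h y - h x) (at_right (0::real))"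
    by (auto simp: eventually_at_right_field intro: exI[of _ 1])
  moreover have "((\<lambda>t. (h (x + t *\<^sub>R (y - x)) - h x) / t) \<longlongrightarrow> g x \<bullet> (y - x)) (at_right (0::real))"
    using assms by (intro gradient_directional_limit diff_feasible_direction)
      (auto intro: convex_on_imp_convex)
  ultimately have "g x \<bullet> (y - x) \<le> h y - h x"
    by (intro tendsto_upperbound) auto
  then show ?thesis
    by simp
qed

lemma minimum_gradient_nonneg:
  assumes "has_gradient_on h g P" "convex P" "x \<in> P" "d \<in> feasible_directions P x"
    and min: "\<And>y. y \<in> P \<Longrightarrow> h x \<le> h y"
  shows "0 \<le> g x \<bullet> d"
proof -
  have "eventually (\<lambda>t. 0 \<le> (h (x + t *\<^sub>R d) - h x) / t) (at_right (0::real))"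
    using eventually_feasible_step[OF assms(2-4)] eventually_at_right_less
    by eventually_elim (use min in simp)
  then show ?thesis
    using gradient_directional_limit[OF assms(1-4)] by (intro tendsto_lowerbound) auto
qed

theorem lemma6:
  fixes P :: "(real^'n) set" and h :: "real^'n \<Rightarrow> real" and g :: "real^'n \<Rightarrow> real^'n"
    and x xstar :: "real^'n"
  assumes "polytope P"
    and "x \<in> P"
    and "has_gradient_on h g P"
    and "convex_on P h"
    and "is_arg_min h (\<lambda>z. z \<in> P) xstar"
  shows "(norm (shadow P g x) = 0 \<longleftrightarrow> is_arg_min h (\<lambda>z. z \<in> P) x) \<and>
    (\<forall>\<mu>. strongly_convex_on \<mu> P h g \<longrightarrow>
       (norm (shadow P g x))\<^sup>2 \<ge> 2 * \<mu> * (h x - h xstar))"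
proof -
  let ?T = "feasible_directions P x"
  define d where "d = shadow P g x"
  have P: "polyhedron P" "convex P"
    using assms(1) by (auto intro: polytope_imp_polyhedron polytope_imp_convex)
  have d_eq: "d = closest_point ?T (- g x)"
    unfolding d_def by (rule shadow_eq_closest_point_feasible_directions[OF P(1) assms(2)])
  have T: "closed ?T" "convex ?T" "0 \<in> ?T"
    using polyhedron_feasible_directions[OF P(1) assms(2)] zero_feasible_direction[OF assms(2)]
    by auto
  have moreau: "- g x \<bullet> d = d \<bullet> d" "\<And>w. w \<in> ?T \<Longrightarrow> - g x \<bullet> w \<le> d \<bullet> w"
    unfolding d_eq
    by (rule closest_point_convex_cone[OF T]; simp add: scaleR_feasible_direction)+
  have "d \<in> ?T"
    unfolding d_eq using T by (intro closest_point_in_set) auto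
  have slope: "- (g x \<bullet> (y - x)) \<le> d \<bullet> (y - x)" if "y \<in> P" for y
    using moreau(2)[OF diff_feasible_direction[OF that]] by simp
  have xstar: "xstar \<in> P" "\<And>y. y \<in> P \<Longrightarrow> h xstar \<le> h y"
    using assms(5) by (auto simp: is_arg_min_linorder)
  have "d = 0 \<longleftrightarrow> is_arg_min h (\<lambda>z. z \<in> P) x"
  proof
    assume "d = 0"
    then have "h x \<le> h y" if "y \<in> P" for y
      using slope[OF that] convex_on_gradient_inequality[OF assms(3,4,2) that] by simp
    with assms(2) show "is_arg_min h (\<lambda>z. z \<in> P) x"
      by (auto simp: is_arg_min_linorder)
  next
    assume "is_arg_min h (\<lambda>z. z \<in> P) x"
    then have "0 \<le> g x \<bullet> d"
      by (intro minimum_gradient_nonneg[OF assms(3) P(2) assms(2) \<open>d \<in> ?T\<close>])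
        (auto simp: is_arg_min_linorder)
    then have "d \<bullet> d \<le> 0"
      using moreau(1) by simp
    then show "d = 0"
      by (metis inner_eq_zero_iff inner_ge_zero order_antisym)
  qed
  moreover have "2 * \<mu> * (h x - h xstar) \<le> (norm d)\<^sup>2" if sc: "strongly_convex_on \<mu> P h g" for \<mu>
  proof (cases "\<mu> > 0")
    case True
    define w where "w = xstar - x"
    have "h x - h xstar \<le> d \<bullet> w - \<mu> / 2 * (w \<bullet> w)"
      using sc assms(2) xstar(1) slope[OF xstar(1)]
      unfolding strongly_convex_on_def w_def power2_norm_eq_inner by fastforce
    then have "2 * \<mu> * (h x - h xstar) \<le> 2 * \<mu> * (d \<bullet> w - \<mu> / 2 * (w \<bullet> w))"
      using True by (intro mult_left_mono) auto
    also have "\<dots> = (norm d)\<^sup>2 - (norm (d - \<mu> *\<^sub>R w))\<^sup>2"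
      by (simp add: power2_norm_eq_inner inner_commute algebra_simps)
    also have "\<dots> \<le> (norm d)\<^sup>2"
      by simp
    finally show ?thesis .
  next
    case False
    then have "2 * \<mu> * (h x - h xstar) \<le> 0"
      using xstar(2)[OF assms(2)] by (simp add: mult_le_0_iff)
    then show ?thesis
      using zero_le_power2 order_trans by blast
  qed
  ultimately show ?thesis
    unfolding d_def[symmetric] by simp
qed

end
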